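(* The forcing $\mathbb{V}^-$ collapses the continuum to $\omega$; that is, $\mathbb{V}^-$ forces that $(2^{\omega})^V$ is countable.
   Context: For $A\subseteq\omega$ the lower density is $d^-(A)=\liminf_{n\to\infty}\frac{|A\cap n|}{n}$ (with $n=\{0,\dots,n-1\}$). Silver forcing $\mathbb{V}$ consists of all functions $f:\omega\setminus A\to 2$ where $A\subseteq\omega$ is infinite, ordered by extension: $g$ is stronger than $f$ iff $g\supseteq f$. Equivalently, a condition is the tree $p=\{t\in 2^{<\omega}: \forall n\in|t|\setminus A\ (t(n)=f(n))\}$ ordered by inclusion, and $A_p:=A$ is its set of splitting levels. $\mathbb{V}^-$ is the suborder of those conditions $p\in\mathbb{V}$ with $d^-(A_p)>0$. $V$ denotes the ground model. *)

theory Defs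
  imports "HOL-Library.Extended_Real"
begin

section \<open>Names\<close>

text \<open>A \<open>\<P>\<close>-name is a set of pairs (name, condition). HOL has no type that is closed under
  arbitrary subsets, so the sets of pairs are presented as families indexed by a type \<open>'i\<close>
  (\<open>None\<close> entries are skipped): the type consists of the names that are hereditarily of
  cardinality at most \<open>'i\<close>. Results should be stated for every sufficiently large \<open>'i\<close>.\<close>

datatype ('i, 'p) name = Name "'i \<Rightarrow> (('i, 'p) name \<times> 'p) option"

fun elems :: "('i, 'p) name \<Rightarrow> (('i, 'p) name \<times> 'p) set" where
  "elems (Name f) = ran f"

text \<open>The name with a given set of pairs. It is meaningful only for sets of cardinality at most
  that of \<open>'i\<close>; see \<open>elems_name_of\<close>.\<close>

definition name_of :: "(('i, 'p) name \<times> 'p) set \<Rightarrow> ('i, 'p) name" where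
  "name_of S = (SOME \<sigma>. elems \<sigma> = S)"

lemma elems_name_of:
  fixes S :: "(('i, 'p) name \<times> 'p) set" and h :: "_ \<Rightarrow> 'i"
  assumes "inj_on h S"
  shows "elems (name_of S) = S"
proof -
  have "ran (\<lambda>i. if i \<in> h ` S then Some (inv_into S h i) else None) = S"
    (is "ran ?g = S")
  proof
    show "ran ?g \<subseteq> S"
      using assms by (auto simp: ran_def split: if_splits)
    show "S \<subseteq> ran ?g"
    proof
      fix x assume "x \<in> S"
      then have "?g (h x) = Some x"
        using assms by simp
      then show "x \<in> ran ?g"
        by (rule ranI)
    qed
  qed
  then have "\<exists>\<sigma> :: ('i, 'p) name. elems \<sigma> = S"
    by (intro exI[of _ "Name _"]) simp
  then show ?thesis
    unfolding name_of_def by (rule someI_ex)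
qed

definition name_child :: "(('i, 'p) name \<times> ('i, 'p) name) set" where
  "name_child = {(\<pi>, \<sigma>). \<exists>s. (\<pi>, s) \<in> elems \<sigma>}"

lemma wf_name_child: "wf (name_child :: (('i, 'p) name \<times> ('i, 'p) name) set)"
proof (rule wfUNIVI)
  fix P :: "('i, 'p) name \<Rightarrow> bool" and x :: "('i, 'p) name"
  assume *: "\<forall>x. (\<forall>y. (y, x) \<in> name_child \<longrightarrow> P y) \<longrightarrow> P x"
  show "P x"
  proof (induction x)
    case (Name f)
    show ?case
    proof (rule *[rule_format])
      fix \<pi> assume "(\<pi>, Name f) \<in> name_child"
      then obtain s i where i: "f i = Some (\<pi>, s)"
        by (auto simp: name_child_def ran_def)
      show "P \<pi>"
        by (rule Name[of "f i" "(\<pi>, s)"]) (auto simp flip: i)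
    qed
  qed
qed


section \<open>The forcing relation\<close>

text \<open>\<open>q \<le> p\<close> means that \<open>q\<close> is the stronger condition.

  The two atomic clauses are the usual ones, with membership unfolded in the clause for equality
  so that the recursion is on a single relation; see \<open>forces_Eq_iff\<close>.\<close>

function forces_eq :: "'p::order_top \<Rightarrow> ('i, 'p) name \<Rightarrow> ('i, 'p) name \<Rightarrow> bool" where
  "forces_eq p \<sigma> \<tau> \<longleftrightarrow>
    (\<forall>x\<in>elems \<sigma>. \<forall>q\<le>p. q \<le> snd x \<longrightarrow>
       (\<exists>r\<le>q. \<exists>y\<in>elems \<tau>. r \<le> snd y \<and> forces_eq r (fst x) (fst y))) \<and>
    (\<forall>y\<in>elems \<tau>. \<forall>q\<le>p. q \<le> snd y \<longrightarrow>
       (\<exists>r\<le>q. \<exists>x\<in>elems \<sigma>. r \<le> snd x \<and> forces_eq r (fst x) (fst y)))"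
  by pat_completeness auto
termination
  by (relation "inv_image name_child (\<lambda>(p, \<sigma>, \<tau>). \<sigma>)")
    (rule wf_inv_image[OF wf_name_child], auto simp: name_child_def)

declare forces_eq.simps [simp del]

definition forces_mem :: "'p::order_top \<Rightarrow> ('i, 'p) name \<Rightarrow> ('i, 'p) name \<Rightarrow> bool" where
  "forces_mem p \<pi> \<tau> \<longleftrightarrow>
    (\<forall>q\<le>p. \<exists>r\<le>q. \<exists>(\<rho>, t)\<in>elems \<tau>. r \<le> t \<and> forces_eq r \<pi> \<rho>)"

text \<open>Formulas of the forcing language have names as parameters; the bound variable of a quantifier
  is represented by a function on names.\<close>

datatype ('i, 'p) fm =
    Mem "('i, 'p) name" "('i, 'p) name"  (infix \<open>\<in>\<^sub>f\<close> 50)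
  | Eq "('i, 'p) name" "('i, 'p) name"  (infix \<open>=\<^sub>f\<close> 50)
  | Neg "('i, 'p) fm"  (\<open>\<not>\<^sub>f _\<close> [40] 40)
  | Conj "('i, 'p) fm" "('i, 'p) fm"  (infixr \<open>\<and>\<^sub>f\<close> 35)
  | Forall "('i, 'p) name \<Rightarrow> ('i, 'p) fm"  (binder \<open>\<forall>\<^sub>f\<close> 10)

primrec forces :: "'p::order_top \<Rightarrow> ('i, 'p) fm \<Rightarrow> bool"  (infix \<open>\<tturnstile>\<close> 5) where
  "forces p (\<sigma> \<in>\<^sub>f \<tau>) = forces_mem p \<sigma> \<tau>"
| "forces p (\<sigma> =\<^sub>f \<tau>) = forces_eq p \<sigma> \<tau>"
| "forces p (\<not>\<^sub>f \<phi>) = (\<forall>q\<le>p. \<not> forces q \<phi>)"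
| "forces p (\<phi> \<and>\<^sub>f \<psi>) = (forces p \<phi> \<and> forces p \<psi>)"
| "forces p (Forall \<phi>) = (\<forall>\<tau>. forces p (\<phi> \<tau>))"

lemma forces_eq_commute: "forces_eq p \<sigma> \<tau> \<longleftrightarrow> forces_eq p \<tau> \<sigma>"
proof (induction \<sigma> arbitrary: p \<tau> rule: wf_induct_rule[OF wf_name_child])
  case (1 \<sigma>)
  have IH: "forces_eq r (fst x) \<rho> \<longleftrightarrow> forces_eq r \<rho> (fst x)" if "x \<in> elems \<sigma>" for r x \<rho>
    using 1 that by (cases x) (auto simp: name_child_def)
  show ?case
    by (simp only: forces_eq.simps[of p \<sigma> \<tau>] forces_eq.simps[of p \<tau> \<sigma>] IH conj_commute
        cong: ball_cong bex_cong conj_cong)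
qed

lemma forces_Eq_iff:
  "(p \<tturnstile> \<sigma> =\<^sub>f \<tau>) \<longleftrightarrow>
    (\<forall>(\<pi>, s)\<in>elems \<sigma>. \<forall>q\<le>p. q \<le> s \<longrightarrow> (q \<tturnstile> \<pi> \<in>\<^sub>f \<tau>)) \<and>
    (\<forall>(\<rho>, t)\<in>elems \<tau>. \<forall>q\<le>p. q \<le> t \<longrightarrow> (q \<tturnstile> \<rho> \<in>\<^sub>f \<sigma>))"
proof -
  have density: "(\<forall>q\<le>p. q \<le> s \<longrightarrow> (\<forall>q'\<le>q. D q')) \<longleftrightarrow> (\<forall>q\<le>p. q \<le> s \<longrightarrow> D q)"
    for s :: 'a and D
    by (blast intro: order_trans)
  have flip: "(\<exists>x\<in>elems \<sigma>. r \<le> snd x \<and> forces_eq r (fst x) \<rho>) \<longleftrightarrow>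
      (\<exists>x\<in>elems \<sigma>. r \<le> snd x \<and> forces_eq r \<rho> (fst x))" for r :: 'a and \<rho>
    by (simp only: forces_eq_commute[of r \<rho>])
  show ?thesis
    unfolding forces.simps forces_mem_def case_prod_unfold density
    by (simp only: forces_eq.simps[of p \<sigma> \<tau>] flip)
qed

definition Disj :: "('i, 'p) fm \<Rightarrow> ('i, 'p) fm \<Rightarrow> ('i, 'p) fm"  (infixr \<open>\<or>\<^sub>f\<close> 30) where
  "(\<phi> \<or>\<^sub>f \<psi>) = (\<not>\<^sub>f (\<not>\<^sub>f \<phi> \<and>\<^sub>f \<not>\<^sub>f \<psi>))"

definition Imp :: "('i, 'p) fm \<Rightarrow> ('i, 'p) fm \<Rightarrow> ('i, 'p) fm"  (infixr \<open>\<longrightarrow>\<^sub>f\<close> 25) where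
  "(\<phi> \<longrightarrow>\<^sub>f \<psi>) = (\<not>\<^sub>f (\<phi> \<and>\<^sub>f \<not>\<^sub>f \<psi>))"

definition Iff :: "('i, 'p) fm \<Rightarrow> ('i, 'p) fm \<Rightarrow> ('i, 'p) fm"  (infixr \<open>\<longleftrightarrow>\<^sub>f\<close> 25) where
  "(\<phi> \<longleftrightarrow>\<^sub>f \<psi>) = ((\<phi> \<longrightarrow>\<^sub>f \<psi>) \<and>\<^sub>f (\<psi> \<longrightarrow>\<^sub>f \<phi>))"

definition Exists :: "(('i, 'p) name \<Rightarrow> ('i, 'p) fm) \<Rightarrow> ('i, 'p) fm"  (binder \<open>\<exists>\<^sub>f\<close> 10) where
  "(\<exists>\<^sub>f x. \<phi> x) = (\<not>\<^sub>f (\<forall>\<^sub>f x. \<not>\<^sub>f \<phi> x))"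


section \<open>Canonical names\<close>

text \<open>The canonical name of a ground-model set is obtained hereditarily by pairing the canonical
  names of its elements with the largest condition. Natural numbers are von Neumann ordinals,
  ordered pairs are Kuratowski pairs, and an element of \<open>2\<^sup>\<omega>\<close> is a set of ordered pairs.\<close>

definition canonical :: "('i, 'p::order_top) name set \<Rightarrow> ('i, 'p) name" where
  "canonical S = name_of (S \<times> {top})"

fun check_nat :: "nat \<Rightarrow> ('i, 'p::order_top) name" where
  "check_nat n = canonical (check_nat ` {..<n})"

declare check_nat.simps [simp del]

definition check_omega :: "('i, 'p::order_top) name" where
  "check_omega = canonical (range check_nat)"

definition canonical_pair ::
    "('i, 'p::order_top) name \<Rightarrow> ('i, 'p) name \<Rightarrow> ('i, 'p) name" where
  "canonical_pair \<sigma> \<tau> = canonical {canonical {\<sigma>}, canonical {\<sigma>, \<tau>}}"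

definition check_real :: "(nat \<Rightarrow> bool) \<Rightarrow> ('i, 'p::order_top) name" where
  "check_real x =
    canonical (range (\<lambda>n. canonical_pair (check_nat n) (check_nat (if x n then 1 else 0))))"

definition check_reals :: "('i, 'p::order_top) name" where
  "check_reals = canonical (range check_real)"


section \<open>Countability in the forcing language\<close>

definition is_upair :: "('i, 'p) name \<Rightarrow> ('i, 'p) name \<Rightarrow> ('i, 'p) name \<Rightarrow> ('i, 'p) fm" where
  "is_upair z x y = (\<forall>\<^sub>f w. w \<in>\<^sub>f z \<longleftrightarrow>\<^sub>f w =\<^sub>f x \<or>\<^sub>f w =\<^sub>f y)"

definition is_pair :: "('i, 'p) name \<Rightarrow> ('i, 'p) name \<Rightarrow> ('i, 'p) name \<Rightarrow> ('i, 'p) fm" where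
  "is_pair z x y = (\<exists>\<^sub>f u. \<exists>\<^sub>f v. is_upair u x x \<and>\<^sub>f is_upair v x y \<and>\<^sub>f is_upair z u v)"

definition pair_mem :: "('i, 'p) name \<Rightarrow> ('i, 'p) name \<Rightarrow> ('i, 'p) name \<Rightarrow> ('i, 'p) fm" where
  "pair_mem x y f = (\<exists>\<^sub>f z. is_pair z x y \<and>\<^sub>f z \<in>\<^sub>f f)"

definition is_function :: "('i, 'p) name \<Rightarrow> ('i, 'p) name \<Rightarrow> ('i, 'p) name \<Rightarrow> ('i, 'p) fm" where
  "is_function f X Y =
    ((\<forall>\<^sub>f z. z \<in>\<^sub>f f \<longrightarrow>\<^sub>f (\<exists>\<^sub>f x. \<exists>\<^sub>f y. x \<in>\<^sub>f X \<and>\<^sub>f y \<in>\<^sub>f Y \<and>\<^sub>f is_pair z x y)) \<and>\<^sub>f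
     (\<forall>\<^sub>f x. x \<in>\<^sub>f X \<longrightarrow>\<^sub>f (\<exists>\<^sub>f y. pair_mem x y f)) \<and>\<^sub>f
     (\<forall>\<^sub>f x. \<forall>\<^sub>f y. \<forall>\<^sub>f y'. pair_mem x y f \<and>\<^sub>f pair_mem x y' f \<longrightarrow>\<^sub>f y =\<^sub>f y'))"

definition is_injection :: "('i, 'p) name \<Rightarrow> ('i, 'p) name \<Rightarrow> ('i, 'p) name \<Rightarrow> ('i, 'p) fm" where
  "is_injection f X Y =
    (is_function f X Y \<and>\<^sub>f
     (\<forall>\<^sub>f x. \<forall>\<^sub>f x'. \<forall>\<^sub>f y. pair_mem x y f \<and>\<^sub>f pair_mem x' y f \<longrightarrow>\<^sub>f x =\<^sub>f x'))"

definition is_countable :: "('i, 'p::order_top) name \<Rightarrow> ('i, 'p) fm" where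
  "is_countable X = (\<exists>\<^sub>f f. is_injection f X check_omega)"


section \<open>Silver forcing and its suborder of conditions of positive lower density\<close>

definition lower_density :: "nat set \<Rightarrow> ereal" where
  "lower_density A = liminf (\<lambda>n. ereal (real (card (A \<inter> {..<n})) / real n))"

text \<open>A function \<open>\<omega> - A \<rightarrow> 2\<close> is a partial map whose domain has complement \<open>A\<close>.\<close>

definition splitting_levels :: "(nat \<rightharpoonup> bool) \<Rightarrow> nat set" where
  "splitting_levels f = - dom f"

definition silver :: "(nat \<rightharpoonup> bool) set" where
  "silver = {f. infinite (splitting_levels f)}"

definition silver_minus :: "(nat \<rightharpoonup> bool) set" where
  "silver_minus = {f \<in> silver. lower_density (splitting_levels f) > 0}"

lemma lower_density_UNIV: "lower_density UNIV = 1"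
proof -
  have "\<forall>\<^sub>F n in sequentially. ereal (real (card (UNIV \<inter> {..<n})) / real n) = 1"
    using eventually_gt_at_top[of 0] by eventually_elim auto
  then have "lower_density UNIV = liminf (\<lambda>n::nat. 1 :: ereal)"
    unfolding lower_density_def by (rule Liminf_eq)
  then show ?thesis
    by (simp add: Liminf_const)
qed

lemma empty_in_silver_minus: "Map.empty \<in> silver_minus"
  by (simp add: silver_minus_def silver_def splitting_levels_def lower_density_UNIV)

typedef silver_minus = silver_minus
  using empty_in_silver_minus by blast

instantiation silver_minus :: order_top
begin

definition less_eq_silver_minus :: "silver_minus \<Rightarrow> silver_minus \<Rightarrow> bool" where
  "g \<le> f \<longleftrightarrow> Rep_silver_minus f \<subseteq>\<^sub>m Rep_silver_minus g"

definition less_silver_minus :: "silver_minus \<Rightarrow> silver_minus \<Rightarrow> bool" where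
  "g < f \<longleftrightarrow> g \<le> f \<and> \<not> f \<le> (g :: silver_minus)"

definition top_silver_minus :: silver_minus where
  "top = Abs_silver_minus Map.empty"

instance
proof
  fix f g h :: silver_minus
  show "f < g \<longleftrightarrow> f \<le> g \<and> \<not> g \<le> f"
    by (rule less_silver_minus_def)
  show "f \<le> f"
    by (simp add: less_eq_silver_minus_def)
  show "f \<le> h" if "f \<le> g" "g \<le> h"
    using that by (auto simp: less_eq_silver_minus_def intro: map_le_trans)
  show "f = g" if "f \<le> g" "g \<le> f"
    using that
    by (simp add: less_eq_silver_minus_def map_le_antisym Rep_silver_minus_inject[symmetric])
  show "f \<le> top"
    by (simp add: less_eq_silver_minus_def top_silver_minus_def Abs_silver_minus_inverse
        empty_in_silver_minus)
qed

end

end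

theory Submission
  imports Defs
begin

text \<open>Suppose that the splitting levels of \<open>p\<close> satisfy \<open>n \<le> m \<cdot> \<bar>A\<^sub>p \<inter> n\<bar> + c\<close>. Leave every \<open>8m\<close>-th
  splitting level free and write on the others a real \<open>y\<close> in an error-correcting code, in which
  distinct reals disagree with density 1/2. A condition with as few free levels as the result is
  then compatible with the code of at most one \<open>y\<close>. A transfinite recursion of length continuum
  over the pairs \<open>(p, x)\<close> with this \<open>m\<close> can therefore choose the \<open>y\<close> so that the resulting conditions
  \<open>T m (p, x) \<le> p\<close> are pairwise incompatible: fewer than continuum many values are excluded at each
  step. The generic filter meets each of these countably many antichains in at most one
  \<open>T m (p, x)\<close>, and by genericity every ground model real \<open>x\<close> occurs for some \<open>m\<close>. Mapping \<open>x\<close> to the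
  least such \<open>m\<close> is injective.\<close>

section \<open>Derived rules of the forcing relation\<close>

lemma forces_eqE:
  assumes "forces_eq p \<sigma> \<tau>" "(\<pi>, s) \<in> elems \<sigma>" "q \<le> p" "q \<le> s"
  obtains r \<rho> t where "r \<le> q" "(\<rho>, t) \<in> elems \<tau>" "r \<le> t" "forces_eq r \<pi> \<rho>"
proof -
  have "\<exists>r\<le>q. \<exists>y\<in>elems \<tau>. r \<le> snd y \<and> forces_eq r \<pi> (fst y)"
    using conjunct1[OF assms(1)[unfolded forces_eq.simps[of p]], rule_format, OF assms(2,3)] assms(4)
    by simp
  then show ?thesis
    using that by auto
qed

lemma forces_mono: "(p \<tturnstile> \<phi>) \<Longrightarrow> q \<le> p \<Longrightarrow> (q \<tturnstile> \<phi>)"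
proof (induction \<phi> arbitrary: p q)
  case (Mem \<sigma> \<tau>)
  then show ?case
    by (auto simp: forces_mem_def dest: order_trans)
next
  case (Eq \<sigma> \<tau>)
  then show ?case
    unfolding forces.simps forces_eq.simps[of p] forces_eq.simps[of q] by (meson order_trans)
next
  case (Forall \<phi>)
  then show ?case
    by (metis forces.simps(5) rangeI)
qed (auto dest: order_trans)

text \<open>Forcing is local: density is built into the atomic and negation clauses and passes
  through conjunction and \<open>Forall\<close>. With \<open>forces_mono\<close> this permits
  strengthening a condition whatever the goal formula is.\<close>

lemma forces_dense:
  assumes "\<And>q. q \<le> p \<Longrightarrow> \<exists>r\<le>q. (r \<tturnstile> \<phi>)"
  shows "p \<tturnstile> \<phi>"
  using assms
proof (induction \<phi> arbitrary: p)
  case (Mem \<sigma> \<tau>)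
  then show ?case
    unfolding forces.simps forces_mem_def by (meson order_trans order_refl)
next
  case (Eq \<sigma> \<tau>)
  show ?case
    unfolding forces.simps forces_eq.simps[of p]
  proof (intro conjI ballI allI impI)
    fix x q assume x: "x \<in> elems \<sigma>" "q \<le> p" "q \<le> snd x"
    obtain r where r: "r \<le> q" "forces_eq r \<sigma> \<tau>"
      using Eq \<open>q \<le> p\<close> by auto
    then obtain r' y where "r' \<le> r" "y \<in> elems \<tau>" "r' \<le> snd y" "forces_eq r' (fst x) (fst y)"
      using x unfolding forces_eq.simps[of r] by (meson order_trans order_refl)
    then show "\<exists>r\<le>q. \<exists>y\<in>elems \<tau>. r \<le> snd y \<and> forces_eq r (fst x) (fst y)"
      using r by (meson order_trans)
  next
    fix y q assume y: "y \<in> elems \<tau>" "q \<le> p" "q \<le> snd y"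
    obtain r where r: "r \<le> q" "forces_eq r \<sigma> \<tau>"
      using Eq \<open>q \<le> p\<close> by auto
    then obtain r' x where "r' \<le> r" "x \<in> elems \<sigma>" "r' \<le> snd x" "forces_eq r' (fst x) (fst y)"
      using y unfolding forces_eq.simps[of r] by (meson order_trans order_refl)
    then show "\<exists>r\<le>q. \<exists>x\<in>elems \<sigma>. r \<le> snd x \<and> forces_eq r (fst x) (fst y)"
      using r by (meson order_trans)
  qed
next
  case (Neg \<phi>)
  then show ?case
    by (meson forces.simps(3) forces_mono order_refl)
next
  case (Conj \<phi> \<psi>)
  then show ?case
    by (metis forces.simps(4))
next
  case (Forall \<phi>)
  then show ?case
    by (metis forces.simps(5) rangeI)
qed

text \<open>From left to right, no condition below a \<open>q\<close> forcing \<open>\<phi>\<close>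
  can force the negation of \<open>\<psi>\<close>, so the conditions forcing \<open>\<psi>\<close>
  are dense below \<open>q\<close>.\<close>

lemma forces_Imp: "(p \<tturnstile> \<phi> \<longrightarrow>\<^sub>f \<psi>) \<longleftrightarrow> (\<forall>q\<le>p. (q \<tturnstile> \<phi>) \<longrightarrow> (q \<tturnstile> \<psi>))"
  unfolding Imp_def forces.simps
  by (meson forces_dense forces_mono order_refl order_trans)

lemma forces_Iff: "(p \<tturnstile> \<phi> \<longleftrightarrow>\<^sub>f \<psi>) \<longleftrightarrow> (\<forall>q\<le>p. (q \<tturnstile> \<phi>) \<longleftrightarrow> (q \<tturnstile> \<psi>))"
  by (auto simp: Iff_def forces_Imp)

lemma forces_Disj: "(p \<tturnstile> \<phi> \<or>\<^sub>f \<psi>) \<longleftrightarrow> (\<forall>q\<le>p. \<exists>r\<le>q. (r \<tturnstile> \<phi>) \<or> (r \<tturnstile> \<psi>))"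
  unfolding Disj_def forces.simps by (meson forces_mono order_refl order_trans)

lemma forces_Exists: "(p \<tturnstile> Exists \<phi>) \<longleftrightarrow> (\<forall>q\<le>p. \<exists>r\<le>q. \<exists>\<tau>. (r \<tturnstile> \<phi> \<tau>))"
  unfolding Exists_def forces.simps by (meson order_refl order_trans)

lemma forces_ExistsI: "(p \<tturnstile> \<phi> \<tau>) \<Longrightarrow> (p \<tturnstile> Exists \<phi>)"
  by (auto simp: forces_Exists intro: forces_mono)

lemma forces_DisjE:
  assumes "p \<tturnstile> \<phi> \<or>\<^sub>f \<psi>"
    and "\<And>q. q \<le> p \<Longrightarrow> (q \<tturnstile> \<phi>) \<Longrightarrow> (q \<tturnstile> \<chi>)"
    and "\<And>q. q \<le> p \<Longrightarrow> (q \<tturnstile> \<psi>) \<Longrightarrow> (q \<tturnstile> \<chi>)"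
  shows "p \<tturnstile> \<chi>"
  using assms by (meson forces_Disj forces_dense order_trans)

lemma forces_DisjI1: "(p \<tturnstile> \<phi>) \<Longrightarrow> (p \<tturnstile> \<phi> \<or>\<^sub>f \<psi>)"
  and forces_DisjI2: "(p \<tturnstile> \<psi>) \<Longrightarrow> (p \<tturnstile> \<phi> \<or>\<^sub>f \<psi>)"
  by (meson forces_Disj forces_mono order_refl)+

lemma forces_ExistsE:
  assumes "p \<tturnstile> Exists \<phi>"
    and "\<And>q \<tau>. q \<le> p \<Longrightarrow> (q \<tturnstile> \<phi> \<tau>) \<Longrightarrow> (q \<tturnstile> \<chi>)"
  shows "p \<tturnstile> \<chi>"
  using assms by (meson forces_Exists forces_dense order_trans)

section \<open>Forced equality as an equivalence relation respected by membership\<close>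

lemma forces_eq_refl: "p \<tturnstile> \<sigma> =\<^sub>f \<sigma>"
proof (induction \<sigma> arbitrary: p rule: wf_induct_rule[OF wf_name_child])
  case (1 \<sigma>)
  then have "forces_eq q (fst x) (fst x)" if "x \<in> elems \<sigma>" for q x
    using that by (cases x) (auto simp: name_child_def)
  then show ?case
    unfolding forces.simps forces_eq.simps[of p] by blast
qed

lemma forces_eq_sym: "(p \<tturnstile> \<sigma> =\<^sub>f \<tau>) \<Longrightarrow> (p \<tturnstile> \<tau> =\<^sub>f \<sigma>)"
  by (simp add: forces_eq_commute)

lemma forces_eq_trans: "(p \<tturnstile> \<sigma> =\<^sub>f \<tau>) \<Longrightarrow> (p \<tturnstile> \<tau> =\<^sub>f \<rho>) \<Longrightarrow> (p \<tturnstile> \<sigma> =\<^sub>f \<rho>)"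
proof (induction \<sigma> arbitrary: p \<tau> \<rho> rule: wf_induct_rule[OF wf_name_child])
  case (1 \<sigma>)
  have IH: "forces_eq r \<pi> \<rho>'" if "(\<pi>, s) \<in> elems \<sigma>" "forces_eq r' \<pi> \<tau>'" "forces_eq r \<tau>' \<rho>'"
    "r \<le> r'" for r r' \<pi> s \<tau>' \<rho>'
    using 1(1)[of \<pi> r \<tau>' \<rho>'] that forces_mono[of r' "\<pi> =\<^sub>f \<tau>'" r]
    by (auto simp: name_child_def)
  \<comment> \<open>The induction is on the left name only. The second half of equality starts from
    an element of \<open>\<rho>\<close>, so there the induction hypothesis is read along the
    reversed chain.\<close>
  have IH': "forces_eq r \<rho>' \<pi>" if "(\<pi>, s) \<in> elems \<sigma>" "forces_eq r' \<rho>' \<tau>'" "forces_eq r \<tau>' \<pi>"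
    "r \<le> r'" for r r' \<pi> s \<tau>' \<rho>'
    using 1(1)[of \<pi> r \<tau>' \<rho>'] that forces_mono[of r' "\<rho>' =\<^sub>f \<tau>'" r]
    by (auto simp: name_child_def forces_eq_commute)
  have eqs: "forces_eq p \<sigma> \<tau>" "forces_eq p \<tau> \<rho>" "forces_eq p \<tau> \<sigma>" "forces_eq p \<rho> \<tau>"
    using 1(2,3) by (simp_all add: forces_eq_commute)
  show ?case
    unfolding forces.simps forces_eq.simps[of p]
  proof (intro conjI ballI allI impI)
    fix x q assume x: "x \<in> elems \<sigma>" "q \<le> p" "q \<le> snd x"
    obtain \<pi> s where [simp]: "x = (\<pi>, s)" by (cases x)
    obtain r \<tau>' t where r: "r \<le> q" "(\<tau>', t) \<in> elems \<tau>" "r \<le> t" "forces_eq r \<pi> \<tau>'"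
      by (rule forces_eqE[OF eqs(1), of \<pi> s q]) (use x in auto)
    obtain r' \<rho>' t' where r': "r' \<le> r" "(\<rho>', t') \<in> elems \<rho>" "r' \<le> t'" "forces_eq r' \<tau>' \<rho>'"
      by (rule forces_eqE[OF eqs(2), of \<tau>' t r]) (use x r in \<open>auto dest: order_trans\<close>)
    have "forces_eq r' \<pi> \<rho>'"
      by (rule IH[OF _ r(4) r'(4) r'(1), of s]) (use x in simp)
    then show "\<exists>r\<le>q. \<exists>y\<in>elems \<rho>. r \<le> snd y \<and> forces_eq r (fst x) (fst y)"
      using r(1) r' by (intro exI[of _ r'] conjI bexI[of _ "(\<rho>', t')"]) auto
  next
    fix y q assume y: "y \<in> elems \<rho>" "q \<le> p" "q \<le> snd y"
    obtain \<rho>' t' where [simp]: "y = (\<rho>', t')" by (cases y)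
    obtain r \<tau>' t where r: "r \<le> q" "(\<tau>', t) \<in> elems \<tau>" "r \<le> t" "forces_eq r \<rho>' \<tau>'"
      by (rule forces_eqE[OF eqs(4), of \<rho>' t' q]) (use y in auto)
    obtain r' \<pi> s where r': "r' \<le> r" "(\<pi>, s) \<in> elems \<sigma>" "r' \<le> s" "forces_eq r' \<tau>' \<pi>"
      by (rule forces_eqE[OF eqs(3), of \<tau>' t r]) (use y r in \<open>auto dest: order_trans\<close>)
    have "forces_eq r' \<pi> \<rho>'"
      using IH'[OF r'(2) r(4) r'(4) r'(1)] by (simp add: forces_eq_commute)
    then show "\<exists>r\<le>q. \<exists>x\<in>elems \<sigma>. r \<le> snd x \<and> forces_eq r (fst x) (fst y)"
      using r(1) r' by (intro exI[of _ r'] conjI bexI[of _ "(\<pi>, s)"]) auto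
  qed
qed

lemma forces_memI:
  assumes "(\<rho>, t) \<in> elems \<tau>" "p \<le> t" "p \<tturnstile> \<pi> =\<^sub>f \<rho>"
  shows "p \<tturnstile> \<pi> \<in>\<^sub>f \<tau>"
  unfolding forces.simps forces_mem_def
proof (intro allI impI)
  fix q assume "q \<le> p"
  then show "\<exists>r\<le>q. \<exists>(\<rho>, t)\<in>elems \<tau>. r \<le> t \<and> forces_eq r \<pi> \<rho>"
    using assms(1) order_trans[OF _ assms(2)] forces_mono[OF assms(3), of q]
    by (intro exI[of _ q] conjI bexI[of _ "(\<rho>, t)"]) auto
qed

lemma forces_memE:
  assumes "p \<tturnstile> \<pi> \<in>\<^sub>f \<tau>"
    and "\<And>q \<rho> t. q \<le> p \<Longrightarrow> (\<rho>, t) \<in> elems \<tau> \<Longrightarrow> q \<le> t \<Longrightarrow> (q \<tturnstile> \<pi> =\<^sub>f \<rho>) \<Longrightarrow> (q \<tturnstile> \<chi>)"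
  shows "p \<tturnstile> \<chi>"
proof (rule forces_dense)
  fix q assume "q \<le> p"
  then obtain r \<rho> t where "r \<le> q" "(\<rho>, t) \<in> elems \<tau>" "r \<le> t" "forces_eq r \<pi> \<rho>"
    using assms(1) unfolding forces.simps forces_mem_def by blast
  then show "\<exists>r\<le>q. (r \<tturnstile> \<chi>)"
    using assms(2)[of r \<rho> t] \<open>q \<le> p\<close> by auto
qed

lemma forces_mem_cong_left:
  assumes "p \<tturnstile> \<pi> =\<^sub>f \<pi>'" "p \<tturnstile> \<pi> \<in>\<^sub>f \<tau>"
  shows "p \<tturnstile> \<pi>' \<in>\<^sub>f \<tau>"
  using assms(2)
proof (rule forces_memE)
  fix q \<rho> t assume q: "q \<le> p" "(\<rho>, t) \<in> elems \<tau>" "q \<le> t" "q \<tturnstile> \<pi> =\<^sub>f \<rho>"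
  show "q \<tturnstile> \<pi>' \<in>\<^sub>f \<tau>"
    using forces_memI[OF q(2,3)] forces_eq_trans[OF forces_eq_sym[OF forces_mono[OF assms(1) q(1)]] q(4)]
    by blast
qed

lemma forces_mem_cong_right:
  assumes "p \<tturnstile> \<sigma> =\<^sub>f \<tau>" "p \<tturnstile> \<pi> \<in>\<^sub>f \<sigma>"
  shows "p \<tturnstile> \<pi> \<in>\<^sub>f \<tau>"
  using assms(2)
proof (rule forces_memE)
  fix q \<rho> t assume q: "q \<le> p" "(\<rho>, t) \<in> elems \<sigma>" "q \<le> t" "q \<tturnstile> \<pi> =\<^sub>f \<rho>"
  have "q \<tturnstile> \<rho> \<in>\<^sub>f \<tau>"
    using assms(1)[unfolded forces_Eq_iff] q by blast
  then show "q \<tturnstile> \<pi> \<in>\<^sub>f \<tau>"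
    using forces_mem_cong_left forces_eq_sym q(4) by blast
qed


section \<open>Unordered and ordered pairs\<close>

lemma forces_is_upair:
  "(p \<tturnstile> is_upair z x y) \<longleftrightarrow>
    (\<forall>w. \<forall>q\<le>p. (q \<tturnstile> w \<in>\<^sub>f z) \<longleftrightarrow> (q \<tturnstile> w =\<^sub>f x \<or>\<^sub>f w =\<^sub>f y))"
  by (simp only: is_upair_def forces.simps(5) forces_Iff)

lemma is_upair_memD:
  assumes "p \<tturnstile> is_upair z x y"
  shows "p \<tturnstile> x \<in>\<^sub>f z" "p \<tturnstile> y \<in>\<^sub>f z"
    and "(p \<tturnstile> w \<in>\<^sub>f z) \<Longrightarrow> (p \<tturnstile> w =\<^sub>f x \<or>\<^sub>f w =\<^sub>f y)"
  using assms forces_eq_refl[of p] forces_DisjI1 forces_DisjI2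
  unfolding forces_is_upair by (metis order_refl)+

lemma is_upair_singleD:
  assumes "p \<tturnstile> is_upair z x x" "p \<tturnstile> w \<in>\<^sub>f z"
  shows "p \<tturnstile> w =\<^sub>f x"
  using is_upair_memD(3)[OF assms] by (rule forces_DisjE)

lemma forces_Disj_eq_cong:
  assumes "p \<tturnstile> w =\<^sub>f x \<or>\<^sub>f w =\<^sub>f y" "p \<tturnstile> x =\<^sub>f x'" "p \<tturnstile> y =\<^sub>f y'"
  shows "p \<tturnstile> w =\<^sub>f x' \<or>\<^sub>f w =\<^sub>f y'"
  using assms(1)
  by (rule forces_DisjE)
    (meson assms(2,3) forces_mono forces_eq_trans forces_DisjI1 forces_DisjI2)+

lemma is_upair_cong:
  assumes "p \<tturnstile> is_upair z x y" "p \<tturnstile> z =\<^sub>f z'" "p \<tturnstile> x =\<^sub>f x'" "p \<tturnstile> y =\<^sub>f y'"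
  shows "p \<tturnstile> is_upair z' x' y'"
  unfolding forces_is_upair
proof (intro allI impI)
  fix w q assume q: "q \<le> p"
  note eqs = assms(2-4)[THEN forces_mono, OF q]
  have "(q \<tturnstile> w \<in>\<^sub>f z') \<longleftrightarrow> (q \<tturnstile> w \<in>\<^sub>f z)"
    using forces_mem_cong_right eqs(1) forces_eq_sym by metis
  also have "\<dots> \<longleftrightarrow> (q \<tturnstile> w =\<^sub>f x \<or>\<^sub>f w =\<^sub>f y)"
    using assms(1) q unfolding forces_is_upair by blast
  also have "\<dots> \<longleftrightarrow> (q \<tturnstile> w =\<^sub>f x' \<or>\<^sub>f w =\<^sub>f y')"
    using forces_Disj_eq_cong[OF _ eqs(2,3)]
      forces_Disj_eq_cong[OF _ eqs(2,3)[THEN forces_eq_sym]] by blast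
  finally show "(q \<tturnstile> w \<in>\<^sub>f z') \<longleftrightarrow> (q \<tturnstile> w =\<^sub>f x' \<or>\<^sub>f w =\<^sub>f y')" .
qed

lemma is_pairI:
  assumes "p \<tturnstile> is_upair u x x" "p \<tturnstile> is_upair v x y" "p \<tturnstile> is_upair z u v"
  shows "p \<tturnstile> is_pair z x y"
  unfolding is_pair_def
  by (rule forces_ExistsI, rule forces_ExistsI[of _ _ v]) (use assms in auto)

lemma is_pairE:
  assumes "p \<tturnstile> is_pair z x y"
    and "\<And>q u v. q \<le> p \<Longrightarrow> (q \<tturnstile> is_upair u x x) \<Longrightarrow> (q \<tturnstile> is_upair v x y) \<Longrightarrow>
      (q \<tturnstile> is_upair z u v) \<Longrightarrow> (q \<tturnstile> \<chi>)"
  shows "p \<tturnstile> \<chi>"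
  using assms(1) unfolding is_pair_def
  by (elim forces_ExistsE) (use assms(2) in \<open>auto intro: order_trans\<close>)

lemma is_pair_cong:
  assumes "p \<tturnstile> is_pair z x y" "p \<tturnstile> z =\<^sub>f z'" "p \<tturnstile> x =\<^sub>f x'" "p \<tturnstile> y =\<^sub>f y'"
  shows "p \<tturnstile> is_pair z' x' y'"
  using assms(1)
proof (rule is_pairE)
  fix q u v
  assume q: "q \<le> p" "q \<tturnstile> is_upair u x x" "q \<tturnstile> is_upair v x y" "q \<tturnstile> is_upair z u v"
  note eqs = assms(2-4)[THEN forces_mono, OF q(1)]
  show "q \<tturnstile> is_pair z' x' y'"
    by (rule is_pairI[of _ u _ v]) (use q eqs in \<open>blast intro: is_upair_cong forces_eq_refl\<close>)+
qed

text \<open>Each element listed in a name is forced to be a member by every condition below the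
  attached one, and \<open>forces_Eq_iff\<close> tests only such elements.\<close>

lemma is_upair_extensional:
  assumes z: "p \<tturnstile> is_upair z x y" and z': "p \<tturnstile> is_upair z' x y"
  shows "p \<tturnstile> z =\<^sub>f z'"
proof -
  have mem: "(q \<tturnstile> w \<in>\<^sub>f z) \<longleftrightarrow> (q \<tturnstile> w \<in>\<^sub>f z')" if "q \<le> p" for q w
    using assms that unfolding forces_is_upair by blast
  have "q \<tturnstile> \<pi> \<in>\<^sub>f \<sigma>" if "(\<pi>, s) \<in> elems \<sigma>" "q \<le> s" for q \<pi> s and \<sigma> :: "('b, 'a) name"
    using that forces_memI forces_eq_refl by metis
  then show ?thesis
    unfolding forces_Eq_iff using mem by blast
qed

text \<open>\<open>y\<close> is \<open>x\<close> or \<open>b\<close>. If it is \<open>x\<close>,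
  then \<open>b\<close>, being \<open>x\<close> or \<open>y\<close>, equals \<open>y\<close> as
  well.\<close>

lemma forces_upair_inject:
  assumes z: "p \<tturnstile> is_upair z x y" and z': "p \<tturnstile> is_upair z x b"
  shows "p \<tturnstile> y =\<^sub>f b"
proof (rule forces_DisjE[OF is_upair_memD(3)[OF z' is_upair_memD(2)[OF z]]])
  fix q assume q: "q \<le> p" "q \<tturnstile> y =\<^sub>f x"
  show "q \<tturnstile> y =\<^sub>f b"
  proof (rule forces_DisjE[OF is_upair_memD(3)[OF z is_upair_memD(2)[OF z'], THEN forces_mono, OF q(1)]])
    fix r assume "r \<le> q" "r \<tturnstile> b =\<^sub>f x"
    then show "r \<tturnstile> y =\<^sub>f b"
      using q(2) forces_mono forces_eq_sym forces_eq_trans by metis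
  qed (rule forces_eq_sym)
qed

lemma forces_pair_inject:
  assumes "p \<tturnstile> is_pair z x y" "p \<tturnstile> is_pair z a b"
  shows "p \<tturnstile> x =\<^sub>f a \<and>\<^sub>f y =\<^sub>f b"
  using assms(1)
proof (rule is_pairE)
  fix q u v
  assume q: "q \<le> p" "q \<tturnstile> is_upair u x x" "q \<tturnstile> is_upair v x y" "q \<tturnstile> is_upair z u v"
  show "q \<tturnstile> x =\<^sub>f a \<and>\<^sub>f y =\<^sub>f b"
    using assms(2)[THEN forces_mono, OF q(1)]
  proof (rule is_pairE)
    fix r u' v'
    assume r: "r \<le> q" "r \<tturnstile> is_upair u' a a" "r \<tturnstile> is_upair v' a b" "r \<tturnstile> is_upair z u' v'"
    note q = q(2-4)[THEN forces_mono, OF r(1)]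
    have u: "r \<tturnstile> u =\<^sub>f u' \<or>\<^sub>f u =\<^sub>f v'"
      using is_upair_memD[OF r(4)] is_upair_memD[OF q(3)] by blast
    \<comment> \<open>The singleton \<open>u\<close> of \<open>x\<close> is either \<open>u'\<close>
      or \<open>v'\<close>. In the first case \<open>x\<close> lies in the singleton of
      \<open>a\<close>; in the second \<open>a\<close> lies in the singleton of
      \<open>x\<close>.\<close>
    have xa: "r \<tturnstile> x =\<^sub>f a"
      using u
    proof (rule forces_DisjE)
      fix s assume s: "s \<le> r" "s \<tturnstile> u =\<^sub>f u'"
      then show "s \<tturnstile> x =\<^sub>f a"
        using is_upair_singleD[OF r(2)[THEN forces_mono, OF s(1)]] forces_mem_cong_right
          is_upair_memD(1)[OF q(1)[THEN forces_mono, OF s(1)]] by blast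
    next
      fix s assume s: "s \<le> r" "s \<tturnstile> u =\<^sub>f v'"
      then show "s \<tturnstile> x =\<^sub>f a"
        using is_upair_singleD[OF q(1)[THEN forces_mono, OF s(1)]] forces_mem_cong_right
          is_upair_memD(1)[OF r(3)[THEN forces_mono, OF s(1)]] forces_eq_sym by blast
    qed
    \<comment> \<open>With \<open>a\<close> replaced by \<open>x\<close>, the names \<open>u\<close>
      and \<open>u'\<close> denote the same singleton. Cancelling it in \<open>z\<close> gives
      \<open>v' = v\<close>, and cancelling \<open>x\<close> in \<open>v\<close> gives
      \<open>y = b\<close>.\<close>
    have "r \<tturnstile> is_upair u' x x" "r \<tturnstile> is_upair v' x b"
      using is_upair_cong[OF r(2)] is_upair_cong[OF r(3)] forces_eq_sym[OF xa] forces_eq_refl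
      by blast+
    moreover have "r \<tturnstile> u' =\<^sub>f u"
      using calculation(1) q(1) by (rule is_upair_extensional)
    moreover have "r \<tturnstile> v' =\<^sub>f v"
      using is_upair_cong[OF r(4)] calculation(3) q(3) forces_eq_refl forces_upair_inject by blast
    ultimately have "r \<tturnstile> y =\<^sub>f b"
      using is_upair_cong[of r v'] q(2) forces_eq_refl forces_upair_inject by blast
    then show "r \<tturnstile> x =\<^sub>f a \<and>\<^sub>f y =\<^sub>f b"
      using xa by simp
  qed
qed


section \<open>Canonical names\<close>

text \<open>Choosing preimages under \<open>F\<close> bounds the size of \<open>S\<close> by that of
  the index type; this is what \<open>elems_name_of\<close> asks for.\<close>

lemma inj_on_subset_range:
  fixes e :: "'a \<Rightarrow> 'i"
  assumes "inj e" "S \<subseteq> range F"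
  shows "inj_on (e \<circ> inv F) S"
  using assms inj_on_inv_into[of S F UNIV] by (auto intro: comp_inj_on inj_on_subset)

lemma elems_canonical:
  fixes e :: "'a \<Rightarrow> 'i" and F :: "'a \<Rightarrow> ('i, 'p::order_top) name"
  assumes "inj e" "S \<subseteq> range F"
  shows "elems (canonical S) = S \<times> {top}"
  unfolding canonical_def
proof (rule elems_name_of)
  show "inj_on ((e \<circ> inv F) \<circ> fst) (S \<times> {top :: 'p})"
    using inj_on_subset_range[OF assms] by (intro comp_inj_on) (auto simp: inj_on_def)
qed

lemma forces_mem_canonicalI:
  assumes "elems \<tau> = S \<times> {top}" "\<sigma> \<in> S" "p \<tturnstile> \<pi> =\<^sub>f \<sigma>"
  shows "p \<tturnstile> \<pi> \<in>\<^sub>f \<tau>"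
  by (rule forces_memI[of \<sigma> top]) (use assms in auto)

lemma forces_mem_canonicalE:
  assumes "p \<tturnstile> \<pi> \<in>\<^sub>f \<tau>" "elems \<tau> = S \<times> {top}"
    and "\<And>q \<sigma>. q \<le> p \<Longrightarrow> \<sigma> \<in> S \<Longrightarrow> (q \<tturnstile> \<pi> =\<^sub>f \<sigma>) \<Longrightarrow> (q \<tturnstile> \<chi>)"
  shows "p \<tturnstile> \<chi>"
  using assms(1) by (rule forces_memE) (use assms(2,3) in auto)

section \<open>Canonical names of pairs, natural numbers and single reals\<close>

context
  fixes e :: "nat \<Rightarrow> 'i"
  assumes e: "inj e"
begin

lemma elems_canonical_doubleton:
  "elems (canonical {\<sigma>, \<tau>} :: ('i, 'p::order_top) name) = {\<sigma>, \<tau>} \<times> {top}"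
proof (rule elems_canonical[OF e])
  show "{\<sigma>, \<tau>} \<subseteq> range (\<lambda>n::nat. if n = 0 then \<sigma> else \<tau>)"
    by (auto simp: image_iff intro: exI[of _ "1::nat"])
qed

lemma forces_is_upair_canonical:
  "p \<tturnstile> is_upair (canonical {\<sigma>, \<tau>} :: ('i, 'p::order_top) name) \<sigma> \<tau>"
  unfolding forces_is_upair
proof (intro allI impI iffI)
  fix w :: "('i, 'p) name" and q
  show "q \<tturnstile> w =\<^sub>f \<sigma> \<or>\<^sub>f w =\<^sub>f \<tau>" if "q \<tturnstile> w \<in>\<^sub>f canonical {\<sigma>, \<tau>}"
    by (rule forces_mem_canonicalE[OF that elems_canonical_doubleton])
      (auto intro: forces_DisjI1 forces_DisjI2)
  show "q \<tturnstile> w \<in>\<^sub>f canonical {\<sigma>, \<tau>}" if "q \<tturnstile> w =\<^sub>f \<sigma> \<or>\<^sub>f w =\<^sub>f \<tau>"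
    using that
    by (rule forces_DisjE) (blast intro: forces_mem_canonicalI[OF elems_canonical_doubleton])+
qed

lemma forces_is_pair_canonical:
  "p \<tturnstile> is_pair (canonical_pair \<sigma> \<tau> :: ('i, 'p::order_top) name) \<sigma> \<tau>"
proof (rule is_pairI[of _ "canonical {\<sigma>}" _ "canonical {\<sigma>, \<tau>}"])
  show "p \<tturnstile> is_upair (canonical {\<sigma>}) \<sigma> \<sigma>"
    using forces_is_upair_canonical[of p \<sigma> \<sigma>] by simp
qed (simp_all only: canonical_pair_def forces_is_upair_canonical)

lemma forces_canonical_pair_inject:
  assumes "p \<tturnstile> canonical_pair \<sigma> \<tau> =\<^sub>f (canonical_pair \<sigma>' \<tau>' :: ('i, 'p::order_top) name)"
  shows "p \<tturnstile> \<sigma> =\<^sub>f \<sigma>'" "p \<tturnstile> \<tau> =\<^sub>f \<tau>'"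
  using forces_pair_inject[OF is_pair_cong[OF forces_is_pair_canonical assms
        forces_eq_refl forces_eq_refl] forces_is_pair_canonical] by auto

lemma elems_check_nat:
  "elems (check_nat n :: ('i, 'p::order_top) name) = check_nat ` {..<n} \<times> {top}"
  unfolding check_nat.simps[of n] by (rule elems_canonical[OF e, of _ check_nat]) auto

lemma elems_check_omega:
  "elems (check_omega :: ('i, 'p::order_top) name) = range check_nat \<times> {top}"
  unfolding check_omega_def by (rule elems_canonical[OF e order_refl])

lemma elems_check_real:
  "elems (check_real x :: ('i, 'p::order_top) name) =
    range (\<lambda>n. canonical_pair (check_nat n) (check_nat (if x n then 1 else 0))) \<times> {top}"
  unfolding check_real_def by (rule elems_canonical[OF e order_refl])

text \<open>As \<open>m\<close> is an element of \<open>n\<close>, forced equality would make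
  \<open>m\<close> equal to some \<open>k < m\<close> below a stronger condition, against the
  induction hypothesis for \<open>k\<close>.\<close>

lemma not_forces_check_nat_eq:
  "m < n \<Longrightarrow> \<not> (p \<tturnstile> check_nat m =\<^sub>f (check_nat n :: ('i, 'p::order_top) name))"
proof (induction m arbitrary: n p rule: less_induct)
  case (less m)
  show ?case
  proof
    assume "p \<tturnstile> check_nat m =\<^sub>f (check_nat n :: ('i, 'p) name)"
    then have "forces_eq p (check_nat n) (check_nat m :: ('i, 'p) name)"
      by (simp add: forces_eq_commute)
    moreover have "(check_nat m, top) \<in> elems (check_nat n :: ('i, 'p) name)"
      using less.prems by (auto simp: elems_check_nat)
    ultimately obtain r \<rho> t where "(\<rho>, t) \<in> elems (check_nat m :: ('i, 'p) name)"
        "forces_eq r (check_nat m) \<rho>"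
      by (rule forces_eqE[OF _ _ order_refl top_greatest])
    then show False
      using less.IH[of _ m r] by (auto simp: elems_check_nat forces_eq_commute)
  qed
qed

lemma forces_check_nat_eqD:
  "(p \<tturnstile> check_nat m =\<^sub>f (check_nat n :: ('i, 'p::order_top) name)) \<Longrightarrow> m = n"
  using not_forces_check_nat_eq forces_eq_sym by (metis linorder_neqE_nat)

lemma forces_check_real_eqD:
  assumes "p \<tturnstile> check_real x =\<^sub>f (check_real y :: ('i, 'p::order_top) name)"
  shows "x = y"
proof
  fix n
  \<comment> \<open>The pair with first entry \<open>n\<close> in \<open>x\<close> must be matched
    by some pair in \<open>y\<close>; injectivity of pairs identifies the positions and then the
    digits.\<close>
  have "(canonical_pair (check_nat n) (check_nat (if x n then 1 else 0)), top) \<in>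
      elems (check_real x :: ('i, 'p) name)"
    by (auto simp: elems_check_real)
  from assms[unfolded forces.simps] this order_refl top_greatest
  obtain r \<rho> t where \<rho>: "(\<rho>, t) \<in> elems (check_real y :: ('i, 'p) name)"
    "forces_eq r (canonical_pair (check_nat n) (check_nat (if x n then 1 else 0))) \<rho>"
    by (rule forces_eqE)
  then obtain k where r: "r \<tturnstile> canonical_pair (check_nat n) (check_nat (if x n then 1 else 0)) =\<^sub>f
      (canonical_pair (check_nat k) (check_nat (if y k then 1 else 0)) :: ('i, 'p) name)"
    by (auto simp: elems_check_real)
  show "x n = y n"
    using r[THEN forces_canonical_pair_inject(1), THEN forces_check_nat_eqD]
      r[THEN forces_canonical_pair_inject(2), THEN forces_check_nat_eqD]
    by (auto split: if_splits)
qed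

end

text \<open>\<open>D x n q\<close> is to be read as: \<open>q\<close> decides that the injection maps \<open>x\<close> to \<open>n\<close>.\<close>

proposition forces_is_countable_check_reals:
  fixes D :: "(nat \<Rightarrow> bool) \<Rightarrow> nat \<Rightarrow> 'p::order_top \<Rightarrow> bool"
    and e :: "(nat \<Rightarrow> bool) \<times> nat \<times> 'p \<Rightarrow> 'i"
  assumes e: "inj e"
    and dense: "\<And>x p. \<exists>q\<le>p. \<exists>n. D x n q"
    and functional: "\<And>x m n q q' r. D x m q \<Longrightarrow> D x n q' \<Longrightarrow> r \<le> q \<Longrightarrow> r \<le> q' \<Longrightarrow> m = n"
    and injective: "\<And>x y n q q' r. D x n q \<Longrightarrow> D y n q' \<Longrightarrow> r \<le> q \<Longrightarrow> r \<le> q' \<Longrightarrow> x = y"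
  shows "top \<tturnstile> is_countable (check_reals :: ('i, 'p) name)"
proof -
  \<comment> \<open>Fixing the other coordinates at dummy values embeds the numbers and the reals
    into the index type.\<close>
  have e_nat: "inj (\<lambda>n. e (\<lambda>_. True, n, top))"
    using e by (auto simp: inj_def)
  have e_real: "inj (\<lambda>x. e (x, 0, top))"
    using e by (auto simp: inj_def)
  have elems_reals: "elems (check_reals :: ('i, 'p) name) = range check_real \<times> {top}"
    unfolding check_reals_def by (rule elems_canonical[OF e_real order_refl])
  \<comment> \<open>The injection is named by attaching to each pair \<open>(x, n)\<close> the
    conditions that decide it. \<open>F\<close> is total on triples, so \<open>e\<close> bounds the
    size of the name.\<close>
  define F :: "(nat \<Rightarrow> bool) \<times> nat \<times> 'p \<Rightarrow> ('i, 'p) name \<times> 'p"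
    where "F = (\<lambda>(x, n, q). (canonical_pair (check_real x) (check_nat n), q))"
  define f where "f = name_of (F ` {(x, n, q). D x n q})"
  have elems_f: "elems f = F ` {(x, n, q). D x n q}"
    unfolding f_def by (rule elems_name_of[OF inj_on_subset_range[OF e]]) (rule image_mono, simp)
  have mem_fE: "q \<tturnstile> \<chi>" if "q \<tturnstile> z \<in>\<^sub>f f" and
    "\<And>r x n t. r \<le> q \<Longrightarrow> D x n t \<Longrightarrow> r \<le> t \<Longrightarrow> (r \<tturnstile> is_pair z (check_real x) (check_nat n)) \<Longrightarrow>
      (r \<tturnstile> \<chi>)" for q z \<chi>
    using that(1)
  proof (rule forces_memE)
    fix r \<rho> t assume r: "r \<le> q" "(\<rho>, t) \<in> elems f" "r \<le> t" "r \<tturnstile> z =\<^sub>f \<rho>"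
    then obtain x n where x: "D x n t" "\<rho> = canonical_pair (check_real x) (check_nat n)"
      by (auto simp: elems_f F_def)
    have "r \<tturnstile> is_pair z (check_real x) (check_nat n)"
      by (rule is_pair_cong[OF forces_is_pair_canonical[OF e_nat]])
        (use r x in \<open>auto intro: forces_eq_sym forces_eq_refl simp del: forces.simps\<close>)
    then show "r \<tturnstile> \<chi>"
      using that(2) r x by blast
  qed
  have pair_mem_fE: "q \<tturnstile> \<chi>" if "q \<tturnstile> pair_mem x y f" and
    "\<And>r x' n t. r \<le> q \<Longrightarrow> D x' n t \<Longrightarrow> r \<le> t \<Longrightarrow> (r \<tturnstile> x =\<^sub>f check_real x') \<Longrightarrow>
      (r \<tturnstile> y =\<^sub>f check_nat n) \<Longrightarrow> (r \<tturnstile> \<chi>)" for q x y \<chi>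
    using that(1) unfolding pair_mem_def
  proof (rule forces_ExistsE)
    fix r z assume r: "r \<le> q" "r \<tturnstile> is_pair z x y \<and>\<^sub>f z \<in>\<^sub>f f"
    then have "r \<tturnstile> z \<in>\<^sub>f f"
      by simp
    then show "r \<tturnstile> \<chi>"
    proof (rule mem_fE)
      fix s x' n t
      assume s: "s \<le> r" "D x' n t" "s \<le> t" "s \<tturnstile> is_pair z (check_real x') (check_nat n)"
      have "s \<tturnstile> is_pair z x y"
        using r(2)[THEN forces_mono, OF s(1)] by simp
      then show "s \<tturnstile> \<chi>"
        using forces_pair_inject[OF _ s(4)] that(2)[of s x' n t] s r(1) by auto
    qed
  qed
  \<comment> \<open>\<open>f1\<close> to \<open>f4\<close> are the clauses of
    \<open>is_injection\<close>: pairs of the right kind, totality, single-valuedness,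
    injectivity.\<close>
  have f1: "q \<tturnstile> (\<exists>\<^sub>f x. \<exists>\<^sub>f y. x \<in>\<^sub>f check_reals \<and>\<^sub>f y \<in>\<^sub>f check_omega \<and>\<^sub>f is_pair z x y)"
    if "q \<tturnstile> z \<in>\<^sub>f f" for q z
    using that
  proof (rule mem_fE)
    fix r x n assume r: "r \<tturnstile> is_pair z (check_real x) (check_nat n)"
    have "r \<tturnstile> check_real x \<in>\<^sub>f (check_reals :: ('i, 'p) name)"
      "r \<tturnstile> check_nat n \<in>\<^sub>f (check_omega :: ('i, 'p) name)"
      by (fact forces_mem_canonicalI[OF elems_reals rangeI forces_eq_refl]
          forces_mem_canonicalI[OF elems_check_omega[OF e_nat] rangeI forces_eq_refl])+
    then show "r \<tturnstile> (\<exists>\<^sub>f x. \<exists>\<^sub>f y. x \<in>\<^sub>f check_reals \<and>\<^sub>f y \<in>\<^sub>f check_omega \<and>\<^sub>f is_pair z x y)"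
      using r by (intro forces_ExistsI[of _ _ "check_real x"] forces_ExistsI[of _ _ "check_nat n"]) simp
  qed
  have f2: "q \<tturnstile> (\<exists>\<^sub>f y. pair_mem x y f)" if "q \<tturnstile> x \<in>\<^sub>f check_reals" for q x
    using that elems_reals
  proof (rule forces_mem_canonicalE)
    fix r \<sigma> assume r: "r \<le> q" "\<sigma> \<in> range check_real" "r \<tturnstile> x =\<^sub>f \<sigma>"
    then obtain x' where x': "\<sigma> = check_real x'"
      by auto
    show "r \<tturnstile> (\<exists>\<^sub>f y. pair_mem x y f)"
    proof (rule forces_dense)
      fix s assume s: "s \<le> r"
      obtain t n where t: "t \<le> s" "D x' n t"
        using dense by blast
      let ?z = "canonical_pair (check_real x') (check_nat n) :: ('i, 'p) name"
      have "t \<tturnstile> is_pair ?z x (check_nat n)"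
        by (rule is_pair_cong[OF forces_is_pair_canonical[OF e_nat] forces_eq_refl _ forces_eq_refl])
          (use forces_mono[OF forces_eq_sym[OF r(3)], of t] x' s t(1) in \<open>auto dest: order_trans\<close>)
      moreover have "t \<tturnstile> ?z \<in>\<^sub>f f"
        using t(2) by (intro forces_memI[OF _ order_refl forces_eq_refl])
          (auto simp: elems_f F_def image_iff)
      ultimately have "t \<tturnstile> (\<exists>\<^sub>f y. pair_mem x y f)"
        unfolding pair_mem_def
        by (intro forces_ExistsI[of _ _ "check_nat n"] forces_ExistsI[of _ _ ?z]) simp
      then show "\<exists>t\<le>s. (t \<tturnstile> (\<exists>\<^sub>f y. pair_mem x y f))"
        using t(1) by blast
    qed
  qed
  \<comment> \<open>Two memberships in \<open>f\<close> are reduced to one \<open>r\<close> below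
    both deciding conditions \<open>t\<close> and \<open>t'\<close>, the situation treated by
    \<open>functional\<close> and \<open>injective\<close>.\<close>
  have pairs: "q \<tturnstile> \<chi>" if "q \<tturnstile> pair_mem x y f \<and>\<^sub>f pair_mem x' y' f" and
    "\<And>r a m b n t t'. r \<le> q \<Longrightarrow> D a m t \<Longrightarrow> D b n t' \<Longrightarrow> r \<le> t \<Longrightarrow> r \<le> t' \<Longrightarrow>
      (r \<tturnstile> x =\<^sub>f check_real a) \<Longrightarrow> (r \<tturnstile> y =\<^sub>f check_nat m) \<Longrightarrow>
      (r \<tturnstile> x' =\<^sub>f check_real b) \<Longrightarrow> (r \<tturnstile> y' =\<^sub>f check_nat n) \<Longrightarrow> (r \<tturnstile> \<chi>)" for q x y x' y' \<chi>
  proof (rule pair_mem_fE[of q x y])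
    fix r a m t
    assume r: "r \<le> q" "D a m t" "r \<le> t" "r \<tturnstile> x =\<^sub>f check_real a" "r \<tturnstile> y =\<^sub>f check_nat m"
    have "r \<tturnstile> pair_mem x' y' f"
      using that(1)[THEN forces_mono, OF r(1)] by simp
    then show "r \<tturnstile> \<chi>"
    proof (rule pair_mem_fE)
      fix s b n t'
      assume s: "s \<le> r" "D b n t'" "s \<le> t'" "s \<tturnstile> x' =\<^sub>f check_real b" "s \<tturnstile> y' =\<^sub>f check_nat n"
      show "s \<tturnstile> \<chi>"
        by (rule that(2)[OF order_trans[OF s(1) r(1)] r(2) s(2) order_trans[OF s(1) r(3)] s(3)
              forces_mono[OF r(4) s(1)] forces_mono[OF r(5) s(1)] s(4,5)])
    qed
  qed (use that(1) in simp)
  have f3: "q \<tturnstile> y =\<^sub>f y'" if "q \<tturnstile> pair_mem x y f \<and>\<^sub>f pair_mem x y' f" for q x y y'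
    using that
  proof (rule pairs)
    fix r a m b n t t'
    assume r: "D a m t" "D b n t'" "r \<le> t" "r \<le> t'"
      "r \<tturnstile> x =\<^sub>f check_real a" "r \<tturnstile> y =\<^sub>f check_nat m"
      "r \<tturnstile> x =\<^sub>f check_real b" "r \<tturnstile> y' =\<^sub>f check_nat n"
    have "a = b"
      using forces_check_real_eqD[OF e_nat] forces_eq_trans[OF forces_eq_sym[OF r(5)] r(7)] by blast
    then have "m = n"
      using functional r by blast
    then show "r \<tturnstile> y =\<^sub>f y'"
      using r forces_eq_trans forces_eq_sym by blast
  qed
  have f4: "q \<tturnstile> x =\<^sub>f x'" if "q \<tturnstile> pair_mem x y f \<and>\<^sub>f pair_mem x' y f" for q x x' y
    using that
  proof (rule pairs)
    fix r a m b n t t'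
    assume r: "D a m t" "D b n t'" "r \<le> t" "r \<le> t'"
      "r \<tturnstile> x =\<^sub>f check_real a" "r \<tturnstile> y =\<^sub>f check_nat m"
      "r \<tturnstile> x' =\<^sub>f check_real b" "r \<tturnstile> y =\<^sub>f check_nat n"
    have "m = n"
      using forces_check_nat_eqD[OF e_nat] forces_eq_trans[OF forces_eq_sym[OF r(6)] r(8)] by blast
    then have "a = b"
      using injective r by blast
    then show "r \<tturnstile> x =\<^sub>f x'"
      using r forces_eq_trans forces_eq_sym by blast
  qed
  have "top \<tturnstile> is_injection f check_reals check_omega"
    unfolding is_injection_def is_function_def forces.simps(4,5) forces_Imp
    using f1 f2 f3[unfolded forces.simps(4)] f4[unfolded forces.simps(4)] by blast
  then show ?thesis
    unfolding is_countable_def by (rule forces_ExistsI)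
qed


section \<open>Counting\<close>

abbreviation count :: "nat set \<Rightarrow> nat \<Rightarrow> nat" where
  "count A n \<equiv> card (A \<inter> {..<n})"

lemma count_Suc: "count A (Suc n) = count A n + of_bool (n \<in> A)"
  by (auto simp: lessThan_Suc)

lemma count_le: "count A n \<le> n"
  using card_mono[of "{..<n}" "A \<inter> {..<n}"] by simp

lemma count_double: "count A (2 * n) = count {s. 2 * s \<in> A} n + count {s. Suc (2 * s) \<in> A} n"
  by (induction n) (simp_all add: count_Suc)

text \<open>\<open>count A a\<close> is the rank of \<open>a\<close> in \<open>A\<close>, and
  enumerating \<open>A\<close> matches its elements below \<open>n\<close> with the ranks below
  \<open>count A n\<close>. Frequencies of sets chosen by rank thus reduce to frequencies of
  \<open>P\<close>.\<close>

lemma count_rank: "count {a \<in> A. count A a \<in> P} n = count P (count A n)"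
  by (induction n) (auto simp: count_Suc)

text \<open>The right side is the ceiling of \<open>n / M\<close>, since 0 counts as a
  multiple.\<close>

lemma count_multiples:
  assumes "M > 0"
  shows "count {r. M dvd r} n = (n + (M - 1)) div M"
proof (induction n)
  case (Suc n)
  have "M dvd n \<longleftrightarrow> Suc (n + (M - 1)) mod M = 0"
    using assms by (simp add: dvd_eq_mod_eq_0)
  with Suc show ?case
    unfolding count_Suc by (simp add: div_Suc del: mod_0_imp_dvd)
qed (use assms in simp)

lemma count_multiples_bounds:
  assumes "M > 0"
  shows "n \<le> M * count {r. M dvd r} n" "M * count {r. M dvd r} n \<le> n + M"
  unfolding count_multiples[OF assms]
  using assms mult_div_mod_eq[of M "n + (M - 1)"] mod_less_divisor[OF assms, of "n + (M - 1)"]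
  by linarith+

lemma lower_density_pos_iff:
  "lower_density A > 0 \<longleftrightarrow> (\<exists>m c. \<forall>n. n \<le> m * count A n + c)"
proof
  assume "lower_density A > 0"
  then obtain d where d: "0 < ereal d" "ereal d < lower_density A"
    using ereal_dense2 by blast
  \<comment> \<open>An integer above \<open>1 / d\<close> turns the eventual real bound into one
    between natural numbers; the finitely many exceptions are absorbed by \<open>c\<close>.\<close>
  obtain k :: nat where k: "1 / d < real k"
    using reals_Archimedean2 by blast
  have "\<forall>\<^sub>F n in sequentially. ereal d < ereal (real (count A n) / real n)"
    using d(2) unfolding lower_density_def by (rule less_LiminfD)
  then have "\<forall>\<^sub>F n in sequentially. n \<le> k * count A n"
    using eventually_gt_at_top[of 0]
  proof eventually_elim
    fix n :: nat assume n: "ereal d < ereal (real (count A n) / real n)" "0 < n"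
    then have "d * real n < real (count A n)"
      by (simp add: field_simps)
    moreover have "1 \<le> real k * d"
      using k d(1) by (simp add: field_simps)
    ultimately have "real n \<le> real k * (d * real n)" "real k * (d * real n) \<le> real k * real (count A n)"
      using mult_right_mono[of 1 "real k * d" "real n"] by (auto simp: mult.assoc intro!: mult_left_mono)
    then have "real n \<le> real (k * count A n)"
      by simp
    then show "n \<le> k * count A n"
      by (simp only: of_nat_le_iff)
  qed
  then obtain c where "n \<le> k * count A n" if "c \<le> n" for n
    by (auto simp: eventually_sequentially)
  then have "\<forall>n. n \<le> k * count A n + c"
    by (meson le_add1 le_add2 nat_le_linear order_trans)
  then show "\<exists>m c. \<forall>n. n \<le> m * count A n + c"
    by blast
next
  assume "\<exists>m c. \<forall>n. n \<le> m * count A n + c"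
  then obtain m c where mc: "\<And>n. n \<le> m * count A n + c"
    by blast
  have m: "m > 0"
    using mc[of "Suc c"] by (cases m) auto
  have "\<forall>\<^sub>F n in sequentially. ereal (1 / (2 * real m)) \<le> ereal (real (count A n) / real n)"
    \<comment> \<open>From here on \<open>c\<close> is at most half of \<open>n\<close>, which costs
      a factor 2 in the density; \<open>Suc\<close> keeps \<open>n\<close> positive.\<close>
    using eventually_ge_at_top[of "Suc (2 * c)"]
  proof eventually_elim
    fix n assume n: "Suc (2 * c) \<le> n"
    then have "n \<le> 2 * m * count A n"
      using mc[of n] by linarith
    then have "real n \<le> 2 * real m * real (count A n)"
      by (metis of_nat_le_iff of_nat_mult of_nat_numeral)
    then show "ereal (1 / (2 * real m)) \<le> ereal (real (count A n) / real n)"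
      using m n by (simp add: field_simps)
  qed
  then have "ereal (1 / (2 * real m)) \<le> lower_density A"
    unfolding lower_density_def by (rule Liminf_bounded)
  moreover have "0 < ereal (1 / (2 * real m))"
    using m by simp
  ultimately show "lower_density A > 0"
    by (rule less_le_trans[rotated])
qed

lemma infinite_of_count:
  assumes "\<forall>n. n \<le> m * count A n + c"
  shows "infinite A"
proof
  assume "finite A"
  then have "count A n \<le> card A" for n
    by (intro card_mono) auto
  then have "n \<le> m * card A + c" for n
    using assms by (meson add_le_mono1 mult_le_mono2 order_trans)
  from this[of "Suc (m * card A + c)"] show False
    by simp
qed

lemma silver_minus_iff:
  "f \<in> silver_minus \<longleftrightarrow> (\<exists>m c. \<forall>n. n \<le> m * count (splitting_levels f) n + c)"
  unfolding silver_minus_def silver_def mem_Collect_eq lower_density_pos_iff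
  using infinite_of_count by blast


section \<open>Coding a real into a condition\<close>

text \<open>\<open>parity_code y r\<close> is the sum modulo 2 of the products of \<open>y i\<close> with the \<open>i\<close>-th binary digit
  of \<open>r\<close>. If \<open>y i \<noteq> y' i\<close>, then flipping the \<open>i\<close>-th digit of \<open>r\<close> interchanges agreement and
  disagreement, so the codes of distinct reals disagree with density 1/2.\<close>

fun parity_code :: "(nat \<Rightarrow> bool) \<Rightarrow> nat \<Rightarrow> bool" where
  "parity_code y r = (if r = 0 then False else (y 0 \<and> odd r) \<noteq> parity_code (y \<circ> Suc) (r div 2))"

declare parity_code.simps [simp del]

lemma parity_code_double:
  "parity_code y (2 * r) = parity_code (y \<circ> Suc) r"
  "parity_code y (Suc (2 * r)) \<longleftrightarrow> y 0 \<noteq> parity_code (y \<circ> Suc) r"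
  by (cases "r = 0"; simp add: parity_code.simps[of y] parity_code.simps[of _ 0])+

text \<open>Induction on an index where the reals differ. If they differ at 0, exactly one of
  \<open>2 * s\<close> and \<open>2 * s + 1\<close> is a disagreement. If they agree at 0, both are
  or neither is, as decided by the shifted reals at \<open>s\<close>.\<close>

lemma count_parity_code_disagree:
  assumes "y \<noteq> y'"
  shows "\<exists>c. \<forall>n. n \<le> 2 * count {r. parity_code y r \<noteq> parity_code y' r} n + c"
proof -
  have *: "\<exists>c. \<forall>n. n \<le> 2 * count {r. parity_code y r \<noteq> parity_code y' r} n + c"
    if "y 0 \<noteq> y' 0" for y y'
  proof -
    let ?D = "{r. parity_code y r \<noteq> parity_code y' r}"
    let ?E = "{r. parity_code (y \<circ> Suc) r \<noteq> parity_code (y' \<circ> Suc) r}"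
    have "n \<le> 2 * count ?D n + 1" for n
    proof -
      have "{s. Suc (2 * s) \<in> ?D} = - ?E"
        using that by (auto simp: parity_code_double)
      moreover have "count ?E k + count (- ?E) k = k" for k
        by (induction k) (auto simp: count_Suc)
      ultimately have "count ?D (2 * (n div 2)) = n div 2"
        unfolding count_double by (simp add: parity_code_double)
      moreover have "count ?D (2 * (n div 2)) \<le> count ?D n"
        by (intro card_mono) auto
      ultimately show ?thesis
        by linarith
    qed
    then show ?thesis
      by blast
  qed
  obtain i where "y i \<noteq> y' i"
    using assms by auto
  then show ?thesis
  proof (induction i arbitrary: y y')
    case (0 y y')
    then show ?case by (rule *)
  next
    case (Suc i y y')
    let ?D = "{r. parity_code y r \<noteq> parity_code y' r}"
    let ?E = "{r. parity_code (y \<circ> Suc) r \<noteq> parity_code (y' \<circ> Suc) r}"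
    show ?case
    proof (cases "y 0 = y' 0")
      case True
      have "(y \<circ> Suc) i \<noteq> (y' \<circ> Suc) i"
        using Suc.prems by simp
      then obtain c where c: "\<forall>n. n \<le> 2 * count ?E n + c"
        using Suc.IH[of "y \<circ> Suc" "y' \<circ> Suc"] by blast
      \<comment> \<open>Halving \<open>n\<close> doubles the constant, and the 1 pays for odd
        \<open>n\<close>.\<close>
      have "n \<le> 2 * count ?D n + (2 * c + 1)" for n
      proof -
        have "{s. 2 * s \<in> ?D} = ?E" "{s. Suc (2 * s) \<in> ?D} = ?E"
          using True by (auto simp: parity_code_double)
        then have "count ?D (2 * (n div 2)) = 2 * count ?E (n div 2)"
          unfolding count_double by simp
        moreover have "count ?D (2 * (n div 2)) \<le> count ?D n"
          by (intro card_mono) auto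
        ultimately show ?thesis
          using c[rule_format, of "n div 2"] by linarith
      qed
      then show ?thesis
        by blast
    next
      case False
      then show ?thesis by (rule *)
    qed
  qed
qed

text \<open>The code is indexed by the rank of a level among the splitting levels, so that
  \<open>count_rank\<close> transfers its density. One rank in \<open>M\<close> stays free to keep
  the result a condition.\<close>

definition encode :: "nat \<Rightarrow> (nat \<Rightarrow> bool) \<Rightarrow> (nat \<rightharpoonup> bool) \<Rightarrow> (nat \<rightharpoonup> bool)" where
  "encode M y f = (\<lambda>a.
    if a \<in> dom f then f a
    else let r = count (splitting_levels f) a in if M dvd r then None else Some (parity_code y r))"

lemma encode_extends: "f \<subseteq>\<^sub>m encode M y f"
  by (simp add: map_le_def encode_def)

lemma splitting_levels_encode:
  "splitting_levels (encode M y f) =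
    {a \<in> splitting_levels f. count (splitting_levels f) a \<in> {r. M dvd r}}"
  by (auto simp: splitting_levels_def encode_def Let_def dom_def split: if_splits)

lemma count_splitting_levels_encode:
  "count (splitting_levels (encode M y f)) n = count {r. M dvd r} (count (splitting_levels f) n)"
  unfolding splitting_levels_encode by (rule count_rank)

lemma encode_in_silver_minus:
  assumes "f \<in> silver_minus" "M > 0"
  shows "encode M y f \<in> silver_minus"
proof -
  obtain m c where mc: "\<And>n. n \<le> m * count (splitting_levels f) n + c"
    using assms(1) by (auto simp: silver_minus_iff)
  have "n \<le> (m * M) * count (splitting_levels (encode M y f)) n + c" for n
    using mc[of n] mult_le_mono2[OF count_multiples_bounds(1)[OF assms(2),
        of "count (splitting_levels f) n"], of m]
    unfolding count_splitting_levels_encode mult.assoc by linarith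
  then show ?thesis
    unfolding silver_minus_iff by blast
qed

text \<open>A condition \<open>q\<close> that leaves few levels free settles the code on all but few of the levels where
  it was written, and two codes disagree on about half of these.\<close>

lemma encode_unique:
  assumes f: "\<forall>n. n \<le> m * count (splitting_levels f) n + c" and "m > 0"
    and q: "\<forall>n. 8 * m * count (splitting_levels q) n \<le> n + 8 * m"
    and g: "q \<subseteq>\<^sub>m g" "encode (8 * m) y f \<subseteq>\<^sub>m g"
    and g': "q \<subseteq>\<^sub>m g'" "encode (8 * m) y' f \<subseteq>\<^sub>m g'"
  shows "y = y'"
proof (rule ccontr)
  assume "y \<noteq> y'"
  let ?A = "splitting_levels f"
  define D where "D = {r. parity_code y r \<noteq> parity_code y' r}"
  define K where "K = {r. 8 * m dvd r}"
  \<comment> \<open>The levels where both codes are written and disagree.\<close>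
  let ?E = "{a \<in> ?A. count ?A a \<in> D - K}"
  obtain d where d: "\<forall>n. n \<le> 2 * count D n + d"
    using count_parity_code_disagree[OF \<open>y \<noteq> y'\<close>] by (auto simp: D_def)
  \<comment> \<open>There \<open>g\<close> and \<open>g'\<close> differ although both extend
    \<open>q\<close>, so \<open>q\<close> must be undefined.\<close>
  have "?E \<subseteq> splitting_levels q"
  proof
    fix a assume a: "a \<in> ?E"
    then have "encode (8 * m) y f a = Some (parity_code y (count ?A a))"
      "encode (8 * m) y' f a = Some (parity_code y' (count ?A a))"
      by (auto simp: encode_def Let_def splitting_levels_def K_def)
    then have "g a = Some (parity_code y (count ?A a))" "g' a = Some (parity_code y' (count ?A a))"
      using g(2) g'(2) by (metis domI map_le_def)+
    then have "g a \<noteq> g' a"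
      using a by (auto simp: D_def)
    moreover have "g a = g' a" if "a \<in> dom q"
      using g(1) g'(1) that by (metis map_le_def)
    ultimately show "a \<in> splitting_levels q"
      by (auto simp: splitting_levels_def)
  qed
  have bound: "count D (count ?A n) \<le> count (splitting_levels q) n + count K (count ?A n)" for n
  proof -
    have "count D (count ?A n) \<le> card ((D - K) \<inter> {..<count ?A n} \<union> K \<inter> {..<count ?A n})"
      by (intro card_mono) auto
    also have "\<dots> \<le> count (D - K) (count ?A n) + count K (count ?A n)"
      by (rule card_Un_le)
    also have "count (D - K) (count ?A n) = count ?E n"
      by (rule count_rank[symmetric])
    also have "count ?E n \<le> count (splitting_levels q) n"
      using \<open>?E \<subseteq> splitting_levels q\<close> by (intro card_mono) auto
    finally show ?thesis
      by simp
  qed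
  \<comment> \<open>Up to constants, \<open>8 * n\<close> is at most \<open>8 * m * ?R\<close>, to
    which the free levels of \<open>q\<close> and the unwritten ranks in \<open>K\<close> contribute
    at most \<open>2 * n\<close> each. The factor 8 thus leaves a contradictory bound on
    \<open>n\<close>.\<close>
  have "4 * n \<le> 8 * c + 32 * m + 8 * m * d" for n
  proof -
    let ?R = "count ?A n"
    have "8 * m * ?R \<le> 8 * m * (2 * (count (splitting_levels q) n + count K ?R) + d)"
      using order_trans[OF d[rule_format, of ?R] add_right_mono[OF mult_le_mono2[OF bound[of n]]]]
      by (rule mult_le_mono2)
    also have "\<dots> = 2 * (8 * m * count (splitting_levels q) n) + 2 * (8 * m * count K ?R) + 8 * m * d"
      by (simp add: algebra_simps)
    also have "\<dots> \<le> 2 * (n + 8 * m) + 2 * (n + 8 * m) + 8 * m * d"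
      using q[rule_format, of n] count_multiples_bounds(2)[of "8 * m" ?R, folded K_def] count_le[of ?A n] \<open>m > 0\<close>
      by (intro add_mono mult_le_mono2) linarith+
    finally have "8 * (m * ?R) \<le> 4 * n + 32 * m + 8 * m * d"
      by simp
    moreover have "8 * n \<le> 8 * (m * ?R) + 8 * c"
      using f[rule_format, of n] by linarith
    ultimately show ?thesis
      by linarith
  qed
  from this[of "Suc (8 * c + 32 * m + 8 * m * d)"] show False
    by simp
qed


section \<open>Antichains of coded conditions\<close>

text \<open>Recursion along a well-order in which every element has fewer predecessors than there
  are values. By \<open>unique\<close> each predecessor excludes at most one value, so some value
  survives.\<close>

lemma transfinite_selection:
  fixes e :: "'a \<Rightarrow> 'y" and bad :: "'a \<Rightarrow> 'y \<Rightarrow> 'a \<Rightarrow> 'y \<Rightarrow> bool"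
  assumes e: "inj_on e J"
    and sym: "\<And>a y b z. bad a y b z \<Longrightarrow> bad b z a y"
    and unique: "\<And>a b y y' z. a \<in> J \<Longrightarrow> b \<in> J \<Longrightarrow> bad a y b z \<Longrightarrow> bad a y' b z \<Longrightarrow> y = y'"
  shows "\<exists>Y. \<forall>a\<in>J. \<forall>b\<in>J. a \<noteq> b \<longrightarrow> \<not> bad a (Y a) b (Y b)"
proof -
  \<comment> \<open>The order is a cardinal, so its proper initial segments are smaller than the
    type \<open>'y\<close>.\<close>
  define r where "r = card_of (UNIV :: 'y set)"
  have r: "Well_order r" "Card_order r" "Field r = UNIV"
    unfolding r_def by (rule card_of_Well_order card_of_Card_order Field_card_of)+
  define R where "R = {(b, a). a \<in> J \<and> b \<in> J \<and> (e b, e a) \<in> r - Id}"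
  have "wf R"
    by (rule wf_subset[OF wf_inv_image[of "r - Id" e]])
      (use r in \<open>auto simp: R_def inv_image_def well_order_on_def\<close>)
  have "\<exists>Y. \<forall>a. \<forall>b. (b, a) \<in> R \<longrightarrow> \<not> bad a (Y a) b (Y b)"
  proof (rule dependent_wf_choice[OF \<open>wf R\<close>])
    fix a and Y :: "'a \<Rightarrow> 'y"
    let ?K = "{b. (b, a) \<in> R}"
    show "\<exists>y. \<forall>b. (b, a) \<in> R \<longrightarrow> \<not> bad a y b (Y b)"
    proof (rule ccontr)
      assume "\<not> ?thesis"
      then have bad: "\<exists>b\<in>?K. bad a y b (Y b)" for y
        by blast
      \<comment> \<open>If every value were excluded, sending each predecessor to the value it
        excludes would map \<open>?K\<close> onto \<open>'y\<close>.\<close>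
      have "UNIV \<subseteq> (\<lambda>b. THE y. bad a y b (Y b)) ` ?K"
      proof
        fix y
        obtain b where b: "b \<in> ?K" "bad a y b (Y b)"
          using bad by blast
        then have "(THE y. bad a y b (Y b)) = y"
          by (intro the_equality) (auto simp: R_def intro: unique)
        then show "y \<in> (\<lambda>b. THE y. bad a y b (Y b)) ` ?K"
          using b(1) by blast
      qed
      then have "(r, card_of ?K) \<in> ordLeq"
        unfolding r_def by (meson surj_imp_ordLeq)
      moreover have "(card_of ?K, card_of (underS r (e a))) \<in> ordLeq"
      proof (rule card_of_ordLeqI)
        show "inj_on e ?K"
          using e by (rule inj_on_subset) (auto simp: R_def)
        show "e b \<in> underS r (e a)" if "b \<in> ?K" for b
          using that by (auto simp: R_def underS_def)
      qed
      moreover have "(card_of (underS r (e a)), r) \<in> ordLess"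
        by (rule card_of_underS[OF r(2)]) (simp add: r(3))
      ultimately show False
        by (meson ordLeq_ordLess_trans ordLeq_transitive ordLess_irreflexive)
    qed
  \<comment> \<open>What remains is that admissibility at \<open>a\<close> depends on
    \<open>Y\<close> only at predecessors of \<open>a\<close>.\<close>
  qed metis
  then obtain Y where Y: "(b, a) \<in> R \<Longrightarrow> \<not> bad a (Y a) b (Y b)" for a b
    by blast
  have "(b, a) \<in> R \<or> (a, b) \<in> R" if "a \<in> J" "b \<in> J" "a \<noteq> b" for a b
  proof -
    have "e a \<noteq> e b"
      using e that by (auto dest: inj_onD)
    then show ?thesis
      using r that
      by (auto simp: R_def well_order_on_def linear_order_on_def total_on_def)
  qed
  then have "\<forall>a\<in>J. \<forall>b\<in>J. a \<noteq> b \<longrightarrow> \<not> bad a (Y a) b (Y b)"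
    using Y sym by metis
  then show ?thesis
    by blast
qed

section \<open>Coding pairs of reals and conditions by reals\<close>

lemma inj_prod_into_reals:
  "\<exists>g :: (nat \<Rightarrow> bool) \<times> (nat \<Rightarrow> bool) \<Rightarrow> (nat \<Rightarrow> bool). inj g"
proof -
  \<comment> \<open>Interleaving: the first real on even positions, the second on odd ones.\<close>
  let ?g = "\<lambda>(p :: (nat \<Rightarrow> bool) \<times> (nat \<Rightarrow> bool)) n. (if even n then fst p else snd p) (n div 2)"
  have "inj ?g"
  proof (rule injI)
    fix p q assume *: "?g p = ?g q"
    have "fst p n = fst q n" "snd p n = snd q n" for n
      using fun_cong[OF *, of "2 * n"] fun_cong[OF *, of "2 * n + 1"] by auto
    then show "p = q"
      by (intro prod_eqI ext) auto
  qed
  then show ?thesis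
    by blast
qed

lemma inj_silver_minus_into_reals: "\<exists>g :: silver_minus \<Rightarrow> (nat \<Rightarrow> bool). inj g"
proof -
  obtain h :: "(nat \<Rightarrow> bool) \<times> (nat \<Rightarrow> bool) \<Rightarrow> (nat \<Rightarrow> bool)" where h: "inj h"
    using inj_prod_into_reals by blast
  have "inj (\<lambda>f :: nat \<rightharpoonup> bool. (\<lambda>n. f n = None, \<lambda>n. f n = Some True))"
  proof (rule injI, rule ext)
    fix f g :: "nat \<rightharpoonup> bool" and n
    assume "(\<lambda>n. f n = None, \<lambda>n. f n = Some True) = (\<lambda>n. g n = None, \<lambda>n. g n = Some True)"
    then have "(f n = None) = (g n = None)" "(f n = Some True) = (g n = Some True)"
      by (simp_all add: fun_eq_iff)
    then show "f n = g n"
      by (cases "f n"; cases "g n") auto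
  qed
  moreover have "inj Rep_silver_minus"
    by (simp add: inj_def Rep_silver_minus_inject)
  ultimately show ?thesis
    by (intro exI) (rule inj_compose[OF h inj_compose])
qed

text \<open>The slope \<open>m\<close> is fixed while \<open>c\<close> may vary, because the coding
  gap \<open>8 * m\<close> depends on the slope alone.\<close>

abbreviation dense_condition :: "nat \<Rightarrow> silver_minus \<Rightarrow> bool" where
  "dense_condition m p \<equiv>
    (\<exists>c. \<forall>n. n \<le> m * count (splitting_levels (Rep_silver_minus p)) n + c)"

text \<open>\<open>transfinite_selection\<close> applies with compatibility as the relation to
  avoid: pairs \<open>(p, x)\<close> embed into the reals, and \<open>encode_unique\<close> provides
  the uniqueness.\<close>

lemma ex_coded_antichain:
  "\<exists>T :: silver_minus \<times> (nat \<Rightarrow> bool) \<Rightarrow> silver_minus.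
    (\<forall>p x. T (p, x) \<le> p) \<and>
    (\<forall>a b r. dense_condition m (fst a) \<and> dense_condition m (fst b) \<and> r \<le> T a \<and> r \<le> T b \<longrightarrow> a = b)"
proof (cases "m = 0")
  \<comment> \<open>For slope 0 the bound fails at large \<open>n\<close>, so no condition qualifies
    and any \<open>T\<close> below the identity works.\<close>
  case True
  then have "\<not> dense_condition m p" for p
    by (metis add_cancel_left_left mult_zero_left not_less_eq_eq order_refl)
  then show ?thesis
    by (intro exI[of _ fst]) auto
next
  case False
  define Q where "Q p y = Abs_silver_minus (encode (8 * m) y (Rep_silver_minus p))" for p y
  have Rep_Q: "Rep_silver_minus (Q p y) = encode (8 * m) y (Rep_silver_minus p)" for p y
    unfolding Q_def using False
    by (intro Abs_silver_minus_inverse encode_in_silver_minus Rep_silver_minus) simp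
  define J :: "(silver_minus \<times> (nat \<Rightarrow> bool)) set" where "J = {a. dense_condition m (fst a)}"
  define bad where "bad a y b z \<longleftrightarrow> (\<exists>r. r \<le> Q (fst a) y \<and> r \<le> Q (fst b) z)"
    for a b :: "silver_minus \<times> (nat \<Rightarrow> bool)" and y z
  obtain g :: "silver_minus \<Rightarrow> (nat \<Rightarrow> bool)"
    and h :: "(nat \<Rightarrow> bool) \<times> (nat \<Rightarrow> bool) \<Rightarrow> (nat \<Rightarrow> bool)" where gh: "inj g" "inj h"
    using inj_silver_minus_into_reals inj_prod_into_reals by blast
  have "\<exists>Y. \<forall>a\<in>J. \<forall>b\<in>J. a \<noteq> b \<longrightarrow> \<not> bad a (Y a) b (Y b)"
  proof (rule transfinite_selection)
    show "inj_on (h \<circ> map_prod g id) J"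
      using gh by (intro inj_on_subset[OF inj_compose[OF gh(2) prod.inj_map]]) auto
    show "bad b z a y" if "bad a y b z" for a y b z
      using that by (auto simp: bad_def)
    fix a b y y' z assume "a \<in> J" and bad: "bad a y b z" "bad a y' b z"
    from \<open>a \<in> J\<close> obtain c where "\<forall>n. n \<le> m * count (splitting_levels (Rep_silver_minus (fst a))) n + c"
      by (auto simp: J_def)
    moreover have "0 < m"
      using False by simp
    \<comment> \<open>Every coded condition is sparse: below \<open>n\<close> it keeps one in
      \<open>8 * m\<close> of at most \<open>n\<close> levels.\<close>
    moreover have "\<forall>n. 8 * m * count (splitting_levels (Rep_silver_minus (Q (fst b) z))) n \<le> n + 8 * m"
      unfolding Rep_Q count_splitting_levels_encode
      using False count_le count_multiples_bounds(2)[of "8 * m"]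
      by (meson add_le_mono1 order_trans mult_pos_pos zero_less_numeral neq0_conv)
    moreover obtain r r' where r: "r \<le> Q (fst a) y" "r \<le> Q (fst b) z" "r' \<le> Q (fst a) y'" "r' \<le> Q (fst b) z"
      using bad by (auto simp: bad_def)
    ultimately show "y = y'"
      using r[unfolded less_eq_silver_minus_def]
      by (intro encode_unique[of m _ c "Rep_silver_minus (Q (fst b) z)" "Rep_silver_minus r" y "Rep_silver_minus r'" y'])
        (simp_all add: Rep_Q)
  qed
  then obtain Y where Y: "\<forall>a\<in>J. \<forall>b\<in>J. a \<noteq> b \<longrightarrow> \<not> bad a (Y a) b (Y b)"
    by blast
  show ?thesis
  proof (intro exI[of _ "\<lambda>a. Q (fst a) (Y a)"] conjI allI impI)
    show "Q (fst (p, x)) (Y (p, x)) \<le> p" for p x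
      by (simp add: less_eq_silver_minus_def Rep_Q encode_extends)
    show "a = b" if "dense_condition m (fst a) \<and> dense_condition m (fst b) \<and>
        r \<le> Q (fst a) (Y a) \<and> r \<le> Q (fst b) (Y b)" for a b r
      using Y that unfolding J_def bad_def by blast
  qed
qed

theorem theorem5p1:
  assumes "\<exists>e :: (nat \<Rightarrow> bool) \<Rightarrow> 'i. inj e"
  shows "top \<tturnstile> is_countable (check_reals :: ('i, silver_minus) name)"
proof -
  have "\<forall>m. \<exists>T :: silver_minus \<times> (nat \<Rightarrow> bool) \<Rightarrow> silver_minus. (\<forall>p x. T (p, x) \<le> p) \<and>
    (\<forall>a b r. dense_condition m (fst a) \<and> dense_condition m (fst b) \<and> r \<le> T a \<and> r \<le> T b \<longrightarrow> a = b)"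
    by (rule allI) (rule ex_coded_antichain)
  from choice[OF this] obtain T :: "nat \<Rightarrow> silver_minus \<times> (nat \<Rightarrow> bool) \<Rightarrow> silver_minus"
    where T_le: "\<And>m p x. T m (p, x) \<le> p"
      and T: "\<And>m a b r. dense_condition m (fst a) \<Longrightarrow> dense_condition m (fst b) \<Longrightarrow>
        r \<le> T m a \<Longrightarrow> r \<le> T m b \<Longrightarrow> a = b"
    by blast
  \<comment> \<open>\<open>B x m q\<close> says that \<open>q\<close> puts into the generic filter a
    member of the \<open>m\<close>-th antichain that carries \<open>x\<close>.\<close>
  define B where "B x m q \<longleftrightarrow> (\<exists>p. dense_condition m p \<and> q \<le> T m (p, x))" for x m q
  have B_inject: "x = y" if "B x m q" "B y m q" for x y m q
    using that T[of m "(_, x)" "(_, y)" q] by (fastforce simp: B_def)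
  \<comment> \<open>\<open>q\<close> decides that \<open>m\<close> is least: no stronger condition
    realises \<open>x\<close> at a smaller index.\<close>
  define D where "D x m q \<longleftrightarrow> B x m q \<and> (\<forall>k<m. \<forall>r\<le>q. \<not> B x k r)" for x m q
  have B_mono: "B x m r" if "B x m q" "r \<le> q" for x m q r
    using that by (auto simp: B_def intro: order_trans)
  obtain e :: "(nat \<Rightarrow> bool) \<Rightarrow> 'i" and g :: "silver_minus \<Rightarrow> (nat \<Rightarrow> bool)"
    and h :: "(nat \<Rightarrow> bool) \<times> (nat \<Rightarrow> bool) \<Rightarrow> (nat \<Rightarrow> bool)" where
    inj: "inj e" "inj g" "inj h"
    using assms inj_silver_minus_into_reals inj_prod_into_reals by blast
  \<comment> \<open>Triples are coded by reals, with a number given by the characteristic function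
    of its singleton.\<close>
  have inj_e: "inj (\<lambda>(x, n, q). e (h (x, h (\<lambda>k. k = n, g q))))"
  proof (rule injI)
    have eq: "(\<lambda>k. k = n) = (\<lambda>k. k = n') \<longleftrightarrow> n = n'" for n n' :: nat
      by metis
    show "a = b" if "(\<lambda>(x, n, q). e (h (x, h (\<lambda>k. k = n, g q)))) a =
        (\<lambda>(x, n, q). e (h (x, h (\<lambda>k. k = n, g q)))) b" for a b
      using that by (cases a; cases b) (simp add: inj[THEN inj_eq] eq)
  qed
  show ?thesis
  proof (rule forces_is_countable_check_reals[OF inj_e, of D])
    fix x p
    have "\<exists>m. dense_condition m p"
      using Rep_silver_minus[of p] unfolding silver_minus_iff .
    then have "\<exists>m. \<exists>q\<le>p. B x m q"
      using T_le unfolding B_def by blast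
    \<comment> \<open>Leastness is taken over all conditions below \<open>p\<close>, so it persists
      below the chosen \<open>q\<close>.\<close>
    then obtain m where m: "\<exists>q\<le>p. B x m q" "\<And>k. k < m \<Longrightarrow> \<not> (\<exists>q\<le>p. B x k q)"
      using exists_least_iff[of "\<lambda>m. \<exists>q\<le>p. B x m q"] by blast
    then show "\<exists>q\<le>p. \<exists>n. D x n q"
      unfolding D_def by (meson order_trans)
  next
    fix x m n q q' r assume *: "D x m q" "D x n q'" "r \<le> q" "r \<le> q'"
    then have "B x m r" "B x n r"
      using B_mono by (auto simp: D_def)
    \<comment> \<open>If the indices differed, the common \<open>r\<close> would realise the smaller
      one below a condition that decided the larger to be least.\<close>
    with * show "m = n"
      unfolding D_def by (metis linorder_neqE_nat)
  next
    fix x y n q q' r assume "D x n q" "D y n q'" "r \<le> q" "r \<le> q'"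
    then show "x = y"
      using B_mono B_inject unfolding D_def by blast
  qed
qed

end
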